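(* Let $f:\mathbb{R}^n\to\mathbb{R}$ be continuously differentiable and convex with a minimizer $x^*$, so that the solution set $\chi^*=\arg\min_{x\in\mathbb{R}^n}f(x)$ is nonempty. Suppose that the gradient $g=\nabla f$ is Lipschitz continuous on an open neighborhood $\Theta$ of the level set $\{x\in\mathbb{R}^n:f(x)\le f(x_0)\}$, i.e. there is $L>0$ with $\|g(x)-g(y)\|\le L\|x-y\|$ for all $x,y\in\Theta$, and that $f$ has a global error bound on $\mathbb{R}^n$: there is a constant $\kappa_f>0$ such that $$\|g(x)\|\ge\kappa_f\|x-\bar x\|\quad\text{for all }x\in\mathbb{R}^n,$$ where $\bar x=[x]_{\chi^*}$ is the projection of $x$ onto $\chi^*$. Let $\{x_k\}$ be generated by the method SMCG_PR (i.e. by SMCG_PR1 or by SMCG_PR2) described in the context, started at $x_0$, with stepsizes $\alpha_k$; suppose that there exists $\bar\alpha>0$ such that $\alpha_k\le\bar\alpha$ for all $k$, and that $\|g_k\|\ne0$ for all $k\ge0$. Then there exists $\theta\in(0,1)$ such that, for all $k$, $$f_k-f(x^* )\le\theta^k\left(f_0-f(x^* )\right).$$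
   Context: Notation: $f_k=f(x_k)$, $g_k=\nabla f(x_k)$, $s_{k-1}=x_k-x_{k-1}$, $y_{k-1}=g_k-g_{k-1}$, $\|\cdot\|$ is the Euclidean norm. SMCG_PR. Fixed parameters: $p>2$ (explicit root formulas are used for $p=3,4$), $0<\delta<\sigma<1$, positive constants $\xi_1,\xi_2,\xi_4,\xi_5$, $\xi_3\in(0,1)$, small positive thresholds $\tau_1,\tau_2$, $\gamma\in(0,1)$, positive integers MaxRestart, MinQuad. Start: $x_0\in\mathbb{R}^n$, $d_0=-g_0$. Iteration: $x_{k+1}=x_k+\alpha_kd_k$, where $\alpha_k>0$ satisfies the nonmonotone Wolfe conditions $f(x_k+\alpha_kd_k)\le C_k+\delta\alpha_kg_k^Td_k$ and $\nabla f(x_k+\alpha_kd_k)^Td_k\ge\sigma g_k^Td_k$. Here $C_0=f_0$, $Q_0=1$, $C_1=\min\{C_0,f_1+1\}$, $Q_1=2$, and for $k\ge1$: $Q_{k+1}=\eta_kQ_k+1$, $C_{k+1}=(\eta_kQ_kC_k+f_{k+1})/Q_{k+1}$, where, with $l=\max(20,n)$, $\eta_k=1$ if $l\nmid k$, while if $l\mid k$ then $\eta_k=0.7$ when $C_k-f_{k+1}>0.999|C_k|$ and $\eta_k=0.999$ otherwise. Consequently $s_{k-1}^Ty_{k-1}>0$ for $k\ge1$. Direction $d_k$, $k\ge1$ (a test containing an undefined quantity is regarded as failing). Tests: - (Q) at least one of the following holds: (i) $t_k\le\tau_1$, or ($t_k\le\tau_2$ and $t_{k-1}\le\tau_2$),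 where $t_k=\left|\frac{2(f_{k-1}-f_k+g_k^Ts_{k-1})}{s_{k-1}^Ty_{k-1}}-1\right|$; (ii) $|\theta_k-1|<\gamma$, where $\theta_k=\frac{f_{k-1}-f_k}{0.5\,s_{k-1}^Ty_{k-1}-g_k^Ts_{k-1}}$; (iii) $(s_{k-1}^Ty_{k-1})^2\le10^{-5}\|s_{k-1}\|^2\|y_{k-1}\|^2$ and $\left(f_k-f_{k-1}-0.5(g_{k-1}^Ts_{k-1}+g_k^Ts_{k-1})\right)^2\le10^{-6}\|s_{k-1}\|^2\|y_{k-1}\|^2$. - (W) $\xi_1\le\frac{s_{k-1}^Ty_{k-1}}{\|s_{k-1}\|^2}\le\frac{\|y_{k-1}\|^2}{s_{k-1}^Ty_{k-1}}\le\xi_2$. - (S) $\frac{|g_k^Ty_{k-1}\,g_k^Ts_{k-1}|}{s_{k-1}^Ty_{k-1}\|g_k\|^2}\le\xi_3$ and $\xi_1\le\frac{s_{k-1}^Ty_{k-1}}{\|s_{k-1}\|^2}$. Quantities: $\rho_k=\frac32\frac{\|y_{k-1}\|^2}{s_{k-1}^Ty_{k-1}}\|g_k\|^2$, $B_k=\begin{pmatrix}\rho_k & g_k^Ty_{k-1} \\ g_k^Ty_{k-1} & s_{k-1}^Ty_{k-1}\end{pmatrix}$, $\Delta_k=\det B_k$, $b_k=(\|g_k\|^2,\,g_k^Ts_{k-1})^T$, $E_k=\begin{pmatrix}\|g_k\|^2 & g_k^Ts_{k-1} \\ g_k^Ts_{k-1} & \|s_{k-1}\|^2\end{pmatrix}$,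 $\bar\mu_k=\frac{1}{\Delta_k}(g_k^Ty_{k-1}g_k^Ts_{k-1}-s_{k-1}^Ty_{k-1}\|g_k\|^2)$, $\bar\nu_k=\frac1{\Delta_k}(g_k^Ty_{k-1}\|g_k\|^2-\rho_kg_k^Ts_{k-1})$. Restart counters IterRestart, IterQuad, Isnotgra start at $0$. Once $x_k$ ($k\ge1$) is computed, IterRestart is increased by 1; with $r_{k-1}=\left|\frac{f_k}{f_{k-1}+0.5(g_{k-1}^Ts_{k-1}+g_k^Ts_{k-1})}-1\right|$ and $\bar r_{k-1}=|f_k-f_{k-1}-0.5(g_{k-1}^Ts_{k-1}+g_k^Ts_{k-1})|$, IterQuad is increased by 1 if $r_{k-1}\le\xi_4$ or $\bar r_{k-1}\le\xi_5$, and reset to $0$ otherwise. Then: 1. If Isnotgra $=$ MaxRestart, or (IterQuad $=$ MinQuad and IterRestart $\ne$ IterQuad): $d_k=-g_k$; reset Isnotgra and IterRestart to $0$. 2. Otherwise, if (W) and (Q) hold: $d_k=\bar\mu_kg_k+\bar\nu_ks_{k-1}$; increase Isnotgra by 1. 3. Otherwise, if (W) holds and (Q) fails: $d_k$ is the regularized direction below; increase Isnotgra by 1. 4. Otherwise ((W) fails), if (S) holds: $d_k=-g_k+\frac{g_k^Ty_{k-1}}{d_{k-1}^Ty_{k-1}}d_{k-1}$ (Hestenes–Stiefel direction); increase Isnotgra by 1. 5. Otherwise: $d_k=-g_k$; reset Isnotgra and IterRestart to $0$. Regularized direction in SMCG_PR1: $\sigma_k=p\,|f_{k-1}-f_k+g_k^Ts_{k-1}-\frac12s_{k-1}^Ty_{k-1}|/(s_{k-1}^Ty_{k-1})^{p/2}$,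 $z^*$ is the unique positive solution of $\sigma_kz^{p-1}+z-\sqrt{b_k^TB_k^{-1}b_k}=0$, and $d_k=\frac{1}{1+\min\{\sigma_k(z^* )^{p-2},1\}}(\bar\mu_kg_k+\bar\nu_ks_{k-1})$. Regularized direction in SMCG_PR2: $d_k=\hat\mu_kg_k+\hat\nu_ks_{k-1}$ with $\hat\mu_k=\frac1{\bar\Delta_k}\left(g_k^Ty_{k-1}g_k^Ts_{k-1}-s_{k-1}^Ty_{k-1}\|g_k\|^2+\lambda(g_k^Ts_{k-1})^2-\lambda\|s_{k-1}\|^2\|g_k\|^2\right)$, $\hat\nu_k=\frac1{\bar\Delta_k}\left(g_k^Ty_{k-1}\|g_k\|^2-\rho_kg_k^Ts_{k-1}\right)$, $\bar\Delta_k=(\rho_k+\lambda\|g_k\|^2)(s_{k-1}^Ty_{k-1}+\lambda\|s_{k-1}\|^2)-(g_k^Ty_{k-1}+\lambda g_k^Ts_{k-1})^2$. If $(g_k^Ts_{k-1})^2>(1-10^{-5})\|g_k\|^2\|s_{k-1}\|^2$ then $\lambda=0$; otherwise $\lambda=\min\left\{\sigma_k(z^* )^{p-2},\frac{\|y_{k-1}\|^2}{s_{k-1}^Ty_{k-1}}\right\}$, where $\sigma_k=p\,|f_{k-1}-f_k+g_k^Ts_{k-1}-\frac12s_{k-1}^Ty_{k-1}|/\|s_{k-1}\|^{p/2}$ and $z^*$ is the unique non-negative solution of $z^2=\sum_{i=1}^2\frac{\beta_i^2}{(\mu_i+\sigma_kz^{p-2})^2}$, with $0<\mu_1\le\mu_2$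 the eigenvalues of $E_k^{-1/2}B_kE_k^{-1/2}$, $V$ orthogonal with $V^TE_k^{-1/2}B_kE_k^{-1/2}V=\mathrm{diag}(\mu_1,\mu_2)$ and $\beta=V^TE_k^{-1/2}b_k$. *)

theory Defs
  imports "HOL-Analysis.Analysis"
begin

text \<open>Symmetric positive definite matrices, and the inverse square root of such a matrix.\<close>

definition spd :: "real^'m^'m \<Rightarrow> bool" where
  "spd A \<longleftrightarrow> transpose A = A \<and> (\<forall>v. v \<noteq> 0 \<longrightarrow> 0 < v \<bullet> (A *v v))"

definition inv_sqrt :: "real^'m^'m \<Rightarrow> real^'m^'m" where
  "inv_sqrt A = (THE R. spd R \<and> R ** R = matrix_inv A)"

text \<open>Reference values of the nonmonotone line search. \<open>F k\<close> is the function value at the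
  \<open>k\<close>-th iterate, \<open>l = max 20 n\<close>.\<close>

definition eta :: "nat \<Rightarrow> nat \<Rightarrow> real \<Rightarrow> real \<Rightarrow> real" where
  "eta l k C Fnext =
     (if \<not> l dvd k then 1 else if C - Fnext > 0.999 * \<bar>C\<bar> then 0.7 else 0.999)"

fun refC :: "nat \<Rightarrow> (nat \<Rightarrow> real) \<Rightarrow> nat \<Rightarrow> real"
  and refQ :: "nat \<Rightarrow> (nat \<Rightarrow> real) \<Rightarrow> nat \<Rightarrow> real" where
  "refC l F 0 = F 0"
| "refC l F (Suc 0) = min (F 0) (F (Suc 0) + 1)"
| "refC l F (Suc (Suc k)) =
     (let e = eta l (Suc k) (refC l F (Suc k)) (F (Suc (Suc k))); Q = refQ l F (Suc k)
      in (e * Q * refC l F (Suc k) + F (Suc (Suc k))) / (e * Q + 1))"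
| "refQ l F 0 = 1"
| "refQ l F (Suc 0) = 2"
| "refQ l F (Suc (Suc k)) =
     (let e = eta l (Suc k) (refC l F (Suc k)) (F (Suc (Suc k)))
      in e * refQ l F (Suc k) + 1)"

datatype variant = PR1 | PR2

text \<open>The two situations in which the method takes \<open>d\<^sub>k = -g\<^sub>k\<close> reset the counters in the same way
  and are merged into \<open>Steepest\<close>.\<close>

datatype branch = Steepest | Quadratic | Regularized | Hestenes_Stiefel

text \<open>Below, \<open>x\<close> is the sequence of iterates and \<open>g\<close> the gradient of \<open>f\<close>. Quantities with index
  \<open>k\<close> that involve \<open>s\<^sub>k\<^sub>-\<^sub>1\<close>, \<open>y\<^sub>k\<^sub>-\<^sub>1\<close> are used for \<open>k \<ge> 1\<close> only. As division by zero is total here,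
  the convention that a test containing an undefined quantity fails is made explicit where a
  quantity may be undefined; the other denominators are nonzero along generated sequences, since
  there \<open>s\<^sub>k\<^sub>-\<^sub>1 \<bullet> y\<^sub>k\<^sub>-\<^sub>1 > 0\<close> and \<open>g\<^sub>k \<noteq> 0\<close>.\<close>

context
  fixes p \<delta> \<sigma> \<xi>\<^sub>1 \<xi>\<^sub>2 \<xi>\<^sub>3 \<xi>\<^sub>4 \<xi>\<^sub>5 \<tau>\<^sub>1 \<tau>\<^sub>2 \<gamma> :: real
    and MaxRestart MinQuad :: nat
    and f :: "real^'n \<Rightarrow> real" and g :: "real^'n \<Rightarrow> real^'n"
    and x :: "nat \<Rightarrow> real^'n"
begin

private abbreviation (input) fv :: "nat \<Rightarrow> real" where "fv k \<equiv> f (x k)"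
private abbreviation (input) gv :: "nat \<Rightarrow> real^'n" where "gv k \<equiv> g (x k)"
private abbreviation (input) s :: "nat \<Rightarrow> real^'n" where "s k \<equiv> x (Suc k) - x k"
private abbreviation (input) y :: "nat \<Rightarrow> real^'n" where "y k \<equiv> gv (Suc k) - gv k"

definition t_val :: "nat \<Rightarrow> real" where
  "t_val k = \<bar>2 * (fv (k-1) - fv k + gv k \<bullet> s (k-1)) / (s (k-1) \<bullet> y (k-1)) - 1\<bar>"

definition testQ1 :: "nat \<Rightarrow> bool" where
  "testQ1 k \<longleftrightarrow> t_val k \<le> \<tau>\<^sub>1 \<or> (t_val k \<le> \<tau>\<^sub>2 \<and> k \<ge> 2 \<and> t_val (k-1) \<le> \<tau>\<^sub>2)"

definition testQ2 :: "nat \<Rightarrow> bool" where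
  "testQ2 k \<longleftrightarrow>
     (let den = 0.5 * (s (k-1) \<bullet> y (k-1)) - gv k \<bullet> s (k-1)
      in den \<noteq> 0 \<and> \<bar>(fv (k-1) - fv k) / den - 1\<bar> < \<gamma>)"

definition testQ3 :: "nat \<Rightarrow> bool" where
  "testQ3 k \<longleftrightarrow>
     (s (k-1) \<bullet> y (k-1))\<^sup>2 \<le> 1 / 10^5 * (norm (s (k-1)))\<^sup>2 * (norm (y (k-1)))\<^sup>2 \<and>
     (fv k - fv (k-1) - 0.5 * (gv (k-1) \<bullet> s (k-1) + gv k \<bullet> s (k-1)))\<^sup>2
       \<le> 1 / 10^6 * (norm (s (k-1)))\<^sup>2 * (norm (y (k-1)))\<^sup>2"

definition testQ :: "nat \<Rightarrow> bool" where
  "testQ k \<longleftrightarrow> testQ1 k \<or> testQ2 k \<or> testQ3 k"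

definition testW :: "nat \<Rightarrow> bool" where
  "testW k \<longleftrightarrow>
     \<xi>\<^sub>1 \<le> (s (k-1) \<bullet> y (k-1)) / (norm (s (k-1)))\<^sup>2 \<and>
     (s (k-1) \<bullet> y (k-1)) / (norm (s (k-1)))\<^sup>2 \<le> (norm (y (k-1)))\<^sup>2 / (s (k-1) \<bullet> y (k-1)) \<and>
     (norm (y (k-1)))\<^sup>2 / (s (k-1) \<bullet> y (k-1)) \<le> \<xi>\<^sub>2"

definition testS :: "nat \<Rightarrow> bool" where
  "testS k \<longleftrightarrow>
     \<bar>(gv k \<bullet> y (k-1)) * (gv k \<bullet> s (k-1))\<bar> / ((s (k-1) \<bullet> y (k-1)) * (norm (gv k))\<^sup>2) \<le> \<xi>\<^sub>3 \<and>
     \<xi>\<^sub>1 \<le> (s (k-1) \<bullet> y (k-1)) / (norm (s (k-1)))\<^sup>2"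

definition rho :: "nat \<Rightarrow> real" where
  "rho k = 3/2 * ((norm (y (k-1)))\<^sup>2 / (s (k-1) \<bullet> y (k-1))) * (norm (gv k))\<^sup>2"

definition Bmat :: "nat \<Rightarrow> real^2^2" where
  "Bmat k = vector [vector [rho k, gv k \<bullet> y (k-1)],
                    vector [gv k \<bullet> y (k-1), s (k-1) \<bullet> y (k-1)]]"

definition bvec :: "nat \<Rightarrow> real^2" where
  "bvec k = vector [(norm (gv k))\<^sup>2, gv k \<bullet> s (k-1)]"

definition Emat :: "nat \<Rightarrow> real^2^2" where
  "Emat k = vector [vector [(norm (gv k))\<^sup>2, gv k \<bullet> s (k-1)],
                    vector [gv k \<bullet> s (k-1), (norm (s (k-1)))\<^sup>2]]"

definition mu_bar :: "nat \<Rightarrow> real" where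
  "mu_bar k = 1 / det (Bmat k) *
     ((gv k \<bullet> y (k-1)) * (gv k \<bullet> s (k-1)) - (s (k-1) \<bullet> y (k-1)) * (norm (gv k))\<^sup>2)"

definition nu_bar :: "nat \<Rightarrow> real" where
  "nu_bar k = 1 / det (Bmat k) *
     ((gv k \<bullet> y (k-1)) * (norm (gv k))\<^sup>2 - rho k * (gv k \<bullet> s (k-1)))"

definition quad_dir :: "nat \<Rightarrow> real^'n" where
  "quad_dir k = mu_bar k *\<^sub>R gv k + nu_bar k *\<^sub>R s (k-1)"

definition sigma_PR1 :: "nat \<Rightarrow> real" where
  "sigma_PR1 k =
     p * \<bar>fv (k-1) - fv k + gv k \<bullet> s (k-1) - 1/2 * (s (k-1) \<bullet> y (k-1))\<bar>
       / (s (k-1) \<bullet> y (k-1)) powr (p/2)"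

definition z_PR1 :: "nat \<Rightarrow> real" where
  "z_PR1 k = (THE z. 0 < z \<and>
     sigma_PR1 k * z powr (p - 1) + z - sqrt (bvec k \<bullet> (matrix_inv (Bmat k) *v bvec k)) = 0)"

definition reg_dir_PR1 :: "nat \<Rightarrow> real^'n" where
  "reg_dir_PR1 k =
     (1 / (1 + min (sigma_PR1 k * z_PR1 k powr (p - 2)) 1)) *\<^sub>R quad_dir k"

definition sigma_PR2 :: "nat \<Rightarrow> real" where
  "sigma_PR2 k =
     p * \<bar>fv (k-1) - fv k + gv k \<bullet> s (k-1) - 1/2 * (s (k-1) \<bullet> y (k-1))\<bar>
       / norm (s (k-1)) powr (p/2)"

text \<open>The matrix \<open>V\<close> is not unique, but the right-hand side of the equation for \<open>z\<close> does not depend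
  on its choice.\<close>

definition z_PR2 :: "nat \<Rightarrow> real" where
  "z_PR2 k = (THE z. 0 \<le> z \<and>
     (\<exists>(\<mu>\<^sub>1::real) (\<mu>\<^sub>2::real) (V::real^2^2) (\<beta>::real^2).
        0 < \<mu>\<^sub>1 \<and> \<mu>\<^sub>1 \<le> \<mu>\<^sub>2 \<and> orthogonal_matrix V \<and>
        transpose V ** (inv_sqrt (Emat k) ** Bmat k ** inv_sqrt (Emat k)) ** V
          = vector [vector [\<mu>\<^sub>1, 0], vector [0, \<mu>\<^sub>2]] \<and>
        \<beta> = transpose V *v (inv_sqrt (Emat k) *v bvec k) \<and>
        z\<^sup>2 = (\<beta>$1)\<^sup>2 / (\<mu>\<^sub>1 + sigma_PR2 k * z powr (p - 2))\<^sup>2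
            + (\<beta>$2)\<^sup>2 / (\<mu>\<^sub>2 + sigma_PR2 k * z powr (p - 2))\<^sup>2))"

definition lambda_PR2 :: "nat \<Rightarrow> real" where
  "lambda_PR2 k =
     (if (gv k \<bullet> s (k-1))\<^sup>2 > (1 - 1 / 10^5) * (norm (gv k))\<^sup>2 * (norm (s (k-1)))\<^sup>2 then 0
      else min (sigma_PR2 k * z_PR2 k powr (p - 2)) ((norm (y (k-1)))\<^sup>2 / (s (k-1) \<bullet> y (k-1))))"

definition Delta_bar :: "nat \<Rightarrow> real" where
  "Delta_bar k =
     (rho k + lambda_PR2 k * (norm (gv k))\<^sup>2)
       * (s (k-1) \<bullet> y (k-1) + lambda_PR2 k * (norm (s (k-1)))\<^sup>2)
     - (gv k \<bullet> y (k-1) + lambda_PR2 k * (gv k \<bullet> s (k-1)))\<^sup>2"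

definition mu_hat :: "nat \<Rightarrow> real" where
  "mu_hat k = 1 / Delta_bar k *
     ((gv k \<bullet> y (k-1)) * (gv k \<bullet> s (k-1)) - (s (k-1) \<bullet> y (k-1)) * (norm (gv k))\<^sup>2
      + lambda_PR2 k * (gv k \<bullet> s (k-1))\<^sup>2
      - lambda_PR2 k * (norm (s (k-1)))\<^sup>2 * (norm (gv k))\<^sup>2)"

definition nu_hat :: "nat \<Rightarrow> real" where
  "nu_hat k = 1 / Delta_bar k *
     ((gv k \<bullet> y (k-1)) * (norm (gv k))\<^sup>2 - rho k * (gv k \<bullet> s (k-1)))"

definition reg_dir_PR2 :: "nat \<Rightarrow> real^'n" where
  "reg_dir_PR2 k = mu_hat k *\<^sub>R gv k + nu_hat k *\<^sub>R s (k-1)"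

text \<open>Whether IterQuad is increased (rather than reset) once \<open>x\<^sub>k\<close> is computed.\<close>

definition near_quadratic :: "nat \<Rightarrow> bool" where
  "near_quadratic k \<longleftrightarrow>
     (let h = 0.5 * (gv (k-1) \<bullet> s (k-1) + gv k \<bullet> s (k-1))
      in (fv (k-1) + h \<noteq> 0 \<and> \<bar>fv k / (fv (k-1) + h) - 1\<bar> \<le> \<xi>\<^sub>4) \<or>
         \<bar>fv k - fv (k-1) - h\<bar> \<le> \<xi>\<^sub>5)"

text \<open>Counter triples are (IterRestart, IterQuad, Isnotgra). \<open>count k\<close> is the update made as soon as
  \<open>x\<^sub>k\<close> is computed, \<open>settle\<close> the one made when \<open>d\<^sub>k\<close> is chosen, and \<open>counters k\<close> holds the values
  after iteration \<open>k\<close> has chosen \<open>d\<^sub>k\<close>.\<close>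

definition count :: "nat \<Rightarrow> nat \<times> nat \<times> nat \<Rightarrow> nat \<times> nat \<times> nat" where
  "count k = (\<lambda>(ir, iq, ng). (ir + 1, if near_quadratic k then iq + 1 else 0, ng))"

definition choose_branch :: "nat \<Rightarrow> nat \<times> nat \<times> nat \<Rightarrow> branch" where
  "choose_branch k = (\<lambda>(ir, iq, ng).
     if ng = MaxRestart \<or> (iq = MinQuad \<and> ir \<noteq> iq) then Steepest
     else if testW k \<and> testQ k then Quadratic
     else if testW k then Regularized
     else if testS k then Hestenes_Stiefel
     else Steepest)"

definition settle :: "branch \<Rightarrow> nat \<times> nat \<times> nat \<Rightarrow> nat \<times> nat \<times> nat" where
  "settle br = (\<lambda>(ir, iq, ng). if br = Steepest then (0, iq, 0) else (ir, iq, ng + 1))"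

primrec counters :: "nat \<Rightarrow> nat \<times> nat \<times> nat" where
  "counters 0 = (0, 0, 0)"
| "counters (Suc k) =
     (let c = count (Suc k) (counters k) in settle (choose_branch (Suc k) c) c)"

definition direction :: "variant \<Rightarrow> (nat \<Rightarrow> real^'n) \<Rightarrow> nat \<Rightarrow> real^'n" where
  "direction v d k =
     (case choose_branch k (count k (counters (k-1))) of
        Steepest \<Rightarrow> - gv k
      | Quadratic \<Rightarrow> quad_dir k
      | Regularized \<Rightarrow> (case v of PR1 \<Rightarrow> reg_dir_PR1 k | PR2 \<Rightarrow> reg_dir_PR2 k)
      | Hestenes_Stiefel \<Rightarrow>
          - gv k + ((gv k \<bullet> y (k-1)) / (d (k-1) \<bullet> y (k-1))) *\<^sub>R d (k-1))"

text \<open>The iterates \<open>x\<close>, directions \<open>d\<close> and stepsizes \<open>\<alpha>\<close> are generated by the method.\<close>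

definition SMCG_PR :: "variant \<Rightarrow> (nat \<Rightarrow> real^'n) \<Rightarrow> (nat \<Rightarrow> real) \<Rightarrow> bool" where
  "SMCG_PR v d \<alpha> \<longleftrightarrow>
     d 0 = - gv 0 \<and>
     (\<forall>k\<ge>1. d k = direction v d k) \<and>
     (\<forall>k. x (Suc k) = x k + \<alpha> k *\<^sub>R d k \<and> 0 < \<alpha> k \<and>
        f (x k + \<alpha> k *\<^sub>R d k) \<le> refC (max 20 CARD('n)) fv k + \<delta> * \<alpha> k * (gv k \<bullet> d k) \<and>
        g (x k + \<alpha> k *\<^sub>R d k) \<bullet> d k \<ge> \<sigma> * (gv k \<bullet> d k))"

end

end

theory Submission
  imports Defs
begin

text \<open>
  Every direction satisfies \<open>g\<^sub>k \<bullet> d\<^sub>k \<le> - c \<parallel>g\<^sub>k\<parallel>\<^sup>2\<close> and \<open>\<parallel>d\<^sub>k\<parallel> \<le> K \<parallel>g\<^sub>k\<parallel>\<close>: the two-dimensional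
  directions are, up to a factor in \<open>[1/2, 1]\<close>, of the form \<open>-(B + \<lambda> E)\<^sup>-\<^sup>1 b\<close> with \<open>\<lambda>\<close> bounded. With
  the curvature condition this bounds \<open>\<alpha>\<^sub>k\<close> from below, so \<open>C\<^sub>k - f\<^sub>k\<^sub>+\<^sub>1\<close> is at least a multiple of
  \<open>\<parallel>g\<^sub>k\<parallel>\<^sup>2\<close>, hence, as \<open>\<alpha>\<^sub>k \<le> \<alpha>bar\<close>, of \<open>\<parallel>g\<^sub>k\<^sub>+\<^sub>1\<parallel>\<^sup>2\<close>. Convexity and the error bound
  give \<open>f\<^sub>k - f\<^sup>* \<le> \<parallel>g\<^sub>k\<parallel>\<^sup>2 / \<kappa>\<close>. As \<open>Q\<^sub>k\<close> stays bounded, \<open>C\<^sub>k - f\<^sup>*\<close>, which dominates \<open>f\<^sub>k - f\<^sup>*\<close>,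
  contracts by a fixed factor.
\<close>

section \<open>The two-dimensional model direction: determinant, descent and size\<close>

text \<open>Determinant of the matrix B + \<lambda> E with \<open>rho\<close> written out. At
  \<lambda> = 0 it is \<open>det (Bmat k)\<close>, at \<lambda> = \<open>lambda_PR2\<close> it is
  \<open>Delta_bar\<close>.\<close>

definition model_denom :: "real \<Rightarrow> 'a::real_inner \<Rightarrow> 'a \<Rightarrow> 'a \<Rightarrow> real" where
  "model_denom lam g s y =
     (3/2 * ((norm y)\<^sup>2 / (s \<bullet> y)) * (norm g)\<^sup>2 + lam * (norm g)\<^sup>2) * (s \<bullet> y + lam * (norm s)\<^sup>2)
     - (g \<bullet> y + lam * (g \<bullet> s))\<^sup>2"

text \<open>The vector \<open>\<mu> g + \<nu> s\<close> with \<open>(\<mu>, \<nu>) = -(B + \<lambda> E)\<^sup>-\<^sup>1 b\<close>, by Cramer's rule.\<close>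

definition model_dir :: "real \<Rightarrow> 'a::real_inner \<Rightarrow> 'a \<Rightarrow> 'a \<Rightarrow> 'a" where
  "model_dir lam g s y =
     (1 / model_denom lam g s y *
       ((g \<bullet> y) * (g \<bullet> s) - (s \<bullet> y) * (norm g)\<^sup>2 + lam * (g \<bullet> s)\<^sup>2
         - lam * (norm s)\<^sup>2 * (norm g)\<^sup>2)) *\<^sub>R g
     + (1 / model_denom lam g s y *
       ((g \<bullet> y) * (norm g)\<^sup>2 - 3/2 * ((norm y)\<^sup>2 / (s \<bullet> y)) * (norm g)\<^sup>2 * (g \<bullet> s))) *\<^sub>R s"

lemma inner_square_le: "(u \<bullet> v)\<^sup>2 \<le> (norm u)\<^sup>2 * (norm (v::'a::real_inner))\<^sup>2"
  using Cauchy_Schwarz_ineq[of u v] by (simp add: power2_norm_eq_inner)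

text \<open>Expand in powers of \<open>lam\<close>. The constant term is det B, where the factor 3/2
  in \<open>rho\<close> leaves one half of \<parallel>y\<parallel>^2 \<parallel>g\<parallel>^2 after
  Cauchy-Schwarz; the other two coefficients are nonnegative, the last one being the Gram
  determinant det E.\<close>

lemma model_denom_lower:
  fixes g s y :: "'a::real_inner"
  assumes sy: "0 < s \<bullet> y" and lam: "0 \<le> lam"
  shows "(norm y)\<^sup>2 * (norm g)\<^sup>2 / 2 \<le> model_denom lam g s y"
proof -
  define G S Y a b m where defs: "G = (norm g)\<^sup>2" "S = (norm s)\<^sup>2" "Y = (norm y)\<^sup>2"
    "a = g \<bullet> y" "b = g \<bullet> s" "m = s \<bullet> y"
  have nn: "0 \<le> G" "0 \<le> S" "0 \<le> Y" "0 < m" using sy by (auto simp: defs)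
  have a: "a\<^sup>2 \<le> G * Y" and b: "b\<^sup>2 \<le> G * S"
    using inner_square_le by (auto simp: defs)
  define r where "r = 3/2 * (Y / m) * G"
  have r0: "0 \<le> r" using nn by (simp add: r_def)
  have rm: "r * m = 3/2 * (Y * G)" using nn by (simp add: r_def)
  \<comment> \<open>The coefficient \<open>r * S + m * G - 2 * (a * b)\<close> of \<open>lam\<close>
    is nonnegative: Cauchy-Schwarz on \<open>a\<close> and \<open>b\<close>, then
    \<open>r * m \<ge> G * Y\<close>, then the inequality between arithmetic and geometric means for
    \<open>r * S\<close> and \<open>m * G\<close>.\<close>
  have "(2 * (a * b))\<^sup>2 = 4 * (a\<^sup>2 * b\<^sup>2)" by (simp add: power_mult_distrib)
  also have "\<dots> \<le> 4 * ((G * Y) * (G * S))"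
    using mult_mono[OF a b] nn by simp
  also have "\<dots> \<le> 4 * ((r * S) * (m * G))"
  proof -
    have "(r * S) * (m * G) = (r * m) * (S * G)" by simp
    also have "\<dots> = 3/2 * ((G * Y) * (G * S))" unfolding rm by (simp add: ac_simps)
    finally have "(r * S) * (m * G) = 3/2 * ((G * Y) * (G * S))" .
    moreover have "0 \<le> (G * Y) * (G * S)" using nn by simp
    ultimately show ?thesis by linarith
  qed
  also have "\<dots> \<le> (r * S + m * G)\<^sup>2"
    using zero_le_power2[of "r * S - m * G"] unfolding power2_sum power2_diff by linarith
  finally have "2 * (a * b) \<le> r * S + m * G"
    using r0 nn by (meson abs_le_square_iff add_nonneg_nonneg less_imp_le mult_nonneg_nonneg
        abs_le_D1 power2_le_imp_le)
  hence "0 \<le> lam * (r * S + m * G - 2 * (a * b))" using lam by simp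
  moreover have "0 \<le> lam\<^sup>2 * (G * S - b\<^sup>2)" using b by simp
  moreover have "model_denom lam g s y =
      r * m - a\<^sup>2 + lam * (r * S + m * G - 2 * (a * b)) + lam\<^sup>2 * (G * S - b\<^sup>2)"
    unfolding model_denom_def by (fold defs, fold r_def) (simp add: algebra_simps power2_eq_square)
  ultimately show ?thesis using a rm by (simp add: defs algebra_simps)
qed

lemma norm_le_of_scale:
  fixes s y :: "'a::real_inner"
  assumes "0 < \<xi>" "\<xi> * (norm s)\<^sup>2 \<le> s \<bullet> y"
  shows "\<xi> * norm s \<le> norm y"
proof (cases "s = 0")
  case False
  have "(\<xi> * norm s) * norm s \<le> norm y * norm s"
    using assms(2) norm_cauchy_schwarz[of s y] by (simp add: power2_eq_square algebra_simps)
  thus ?thesis using False by simp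
qed auto

text \<open>By the first row of \<open>M = B + \<lambda> E\<close>, completing the square gives
  \<open>b \<bullet> M\<^sup>-\<^sup>1 b \<ge> b\<^sub>1\<^sup>2 / M\<^sub>1\<^sub>1\<close>.\<close>

lemma model_dir_descent:
  fixes g s y :: "'a::real_inner"
  assumes sy: "0 < s \<bullet> y" and lam: "0 \<le> lam" "lam \<le> \<xi>" and y: "(norm y)\<^sup>2 / (s \<bullet> y) \<le> \<xi>"
    and g: "g \<noteq> 0" and xi: "0 < \<xi>"
  shows "g \<bullet> model_dir lam g s y \<le> - (2 / (5 * \<xi>)) * (norm g)\<^sup>2"
proof -
  define G S Y a b m where defs: "G = (norm g)\<^sup>2" "S = (norm s)\<^sup>2" "Y = (norm y)\<^sup>2"
    "a = g \<bullet> y" "b = g \<bullet> s" "m = s \<bullet> y"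
  define r where "r = 3/2 * (Y / m) * G"
  define D where "D = model_denom lam g s y"
  define P where "P = r + lam * G"
  have y0: "y \<noteq> 0" using sy by auto
  have G: "0 < G" using g by (simp add: defs)
  have D: "0 < D"
    using model_denom_lower[OF sy lam(1), of g] y0 g
    unfolding D_def by (smt (verit) divide_pos_pos mult_pos_pos norm_eq_zero zero_less_power2)
  have Ym: "0 < Y / m" using y0 sy by (simp add: defs)
  have r: "0 < r" unfolding r_def using Ym G by (intro mult_pos_pos) auto
  have P: "0 < P" using r lam G by (simp add: P_def add_pos_nonneg)
  \<comment> \<open>The first entry of B + \<lambda> E is at most (3/2 + 1) \<xi>
    \<parallel>g\<parallel>^2, whence the constant 2 / (5 \<xi>).\<close>
  have "r \<le> 3/2 * \<xi> * G" unfolding r_def using y G by (intro mult_right_mono mult_left_mono) (auto simp: defs)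
  moreover have "lam * G \<le> \<xi> * G" using lam G by (auto intro: mult_right_mono)
  ultimately have Pu: "P \<le> 5/2 * \<xi> * G" by (simp add: P_def)
  have Ddef: "D = (r + lam * G) * (m + lam * S) - (a + lam * b)\<^sup>2"
    unfolding D_def model_denom_def by (fold defs, fold r_def) simp
  define N where "N = (a * b - m * G + lam * b\<^sup>2 - lam * S * G) * G + (a * G - r * b) * b"
  have gd: "g \<bullet> model_dir lam g s y = N / D"
    unfolding model_dir_def inner_add_right inner_scaleR_right power2_norm_eq_inner[symmetric]
    by (fold defs, fold r_def D_def) (simp add: N_def add_divide_distrib)
  \<comment> \<open>As the vector b is the first column of E, the \<lambda>-terms cancel in the
    second Cramer numerator: \<open>a * G - r * b\<close> equals
    \<open>(a + lam * b) * G - P * b\<close>.\<close>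
  have "P * N = - ((P * b - (a + lam * b) * G)\<^sup>2 + D * G\<^sup>2)"
    unfolding N_def Ddef P_def by (simp add: algebra_simps power2_eq_square)
  hence "P * N \<le> - (D * G\<^sup>2)" by simp
  hence "N / D \<le> - (G\<^sup>2 / P)" using P D by (simp add: field_simps)
  moreover have "2 / (5 * \<xi>) * G \<le> G\<^sup>2 / P"
  proof -
    have "2 / (5 * \<xi>) * G * P \<le> 2 / (5 * \<xi>) * G * (5/2 * \<xi> * G)"
      using Pu G xi by (intro mult_left_mono) auto
    also have "\<dots> = G\<^sup>2" using xi by (simp add: power2_eq_square)
    finally show ?thesis using P by (simp add: pos_le_divide_eq)
  qed
  ultimately show ?thesis unfolding gd defs by simp
qed

text \<open>Both Cramer numerators are estimated by Cauchy-Schwarz and compared with the lower bound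
  of the determinant. Only the ratios \<parallel>s\<parallel> / \<parallel>y\<parallel> and
  \<parallel>s\<parallel>^2 / (s \<bullet> y) remain, each at most \<open>1 / \<xi>\<^sub>0\<close>.
  The 9 is 4 from the part along \<open>g\<close> plus 5 from the part along
  \<open>s\<close>.\<close>

lemma model_dir_norm:
  fixes g s y :: "'a::real_inner"
  assumes sy: "0 < s \<bullet> y" and lam: "0 \<le> lam" "lam \<le> \<xi>" and xi0: "0 < \<xi>\<^sub>0"
    and scale: "\<xi>\<^sub>0 * (norm s)\<^sup>2 \<le> s \<bullet> y" and g: "g \<noteq> 0"
  shows "norm (model_dir lam g s y) \<le> (9 / \<xi>\<^sub>0 + 2 * \<xi> / \<xi>\<^sub>0\<^sup>2) * norm g"
proof -
  define n t w where nd: "n = norm g" "t = norm s" "w = norm y"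
  define D where "D = model_denom lam g s y"
  have pos: "0 < n" "0 < t" "0 < w" using g sy by (auto simp: nd)
  have tw: "\<xi>\<^sub>0 * t \<le> w" using norm_le_of_scale[OF xi0 scale] by (simp add: nd)
  have Dl: "w\<^sup>2 * n\<^sup>2 / 2 \<le> D" using model_denom_lower[OF sy lam(1), of g] by (simp add: D_def nd)
  have D: "0 < D" using Dl pos by (smt (verit) divide_pos_pos mult_pos_pos zero_less_power)
  have a: "\<bar>g \<bullet> y\<bar> \<le> n * w" and b: "\<bar>g \<bullet> s\<bar> \<le> n * t" and m: "\<bar>s \<bullet> y\<bar> \<le> t * w"
    unfolding nd by (rule Cauchy_Schwarz_ineq2)+
  have q1: "t / w \<le> 1 / \<xi>\<^sub>0" using tw pos xi0 by (simp add: field_simps)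
  have q2: "t\<^sup>2 / (s \<bullet> y) \<le> 1 / \<xi>\<^sub>0" using scale sy xi0 by (simp add: field_simps nd)
  define A where "A = (g \<bullet> y) * (g \<bullet> s) - (s \<bullet> y) * n\<^sup>2 + lam * (g \<bullet> s)\<^sup>2 - lam * t\<^sup>2 * n\<^sup>2"
  define C where "C = (g \<bullet> y) * n\<^sup>2 - 3/2 * (w\<^sup>2 / (s \<bullet> y)) * n\<^sup>2 * (g \<bullet> s)"
  have dir: "model_dir lam g s y = (1 / D * A) *\<^sub>R g + (1 / D * C) *\<^sub>R s"
    by (simp add: model_dir_def A_def C_def D_def nd)
  have ab: "\<bar>(g \<bullet> y) * (g \<bullet> s)\<bar> \<le> (n * w) * (n * t)"
    unfolding abs_mult using a b pos by (intro mult_mono) auto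
  have mn: "\<bar>(s \<bullet> y) * n\<^sup>2\<bar> \<le> (t * w) * n\<^sup>2"
    unfolding abs_mult using m by (intro mult_mono) auto
  have l: "\<bar>lam * ((g \<bullet> s)\<^sup>2 - t\<^sup>2 * n\<^sup>2)\<bar> \<le> \<xi> * (t\<^sup>2 * n\<^sup>2)"
  proof -
    have "(g \<bullet> s)\<^sup>2 \<le> t\<^sup>2 * n\<^sup>2" using inner_square_le[of g s] by (simp add: nd mult.commute)
    thus ?thesis unfolding abs_mult using lam by (intro mult_mono) auto
  qed
  have "A = (g \<bullet> y) * (g \<bullet> s) - (s \<bullet> y) * n\<^sup>2 + lam * ((g \<bullet> s)\<^sup>2 - t\<^sup>2 * n\<^sup>2)"
    by (simp add: A_def algebra_simps)
  hence "\<bar>A\<bar> \<le> (n * w) * (n * t) + (t * w) * n\<^sup>2 + \<xi> * (t\<^sup>2 * n\<^sup>2)"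
    using ab mn l by linarith
  \<comment> \<open>Factoring out the lower bound of \<open>D\<close> leaves a polynomial in
    \<open>t / w\<close>.\<close>
  also have "\<dots> = (w\<^sup>2 * n\<^sup>2 / 2) * (4 * (t / w) + 2 * \<xi> * (t / w)\<^sup>2)"
    using pos by (simp add: field_simps power2_eq_square)
  also have "\<dots> \<le> (w\<^sup>2 * n\<^sup>2 / 2) * (4 * (1 / \<xi>\<^sub>0) + 2 * \<xi> * (1 / \<xi>\<^sub>0)\<^sup>2)"
    using q1 pos lam xi0 by (intro mult_left_mono add_mono power_mono) auto
  also have "\<dots> \<le> D * (4 * (1 / \<xi>\<^sub>0) + 2 * \<xi> * (1 / \<xi>\<^sub>0)\<^sup>2)"
    using Dl lam xi0 by (intro mult_right_mono) auto
  finally have A: "\<bar>A\<bar> / D \<le> 4 * (1 / \<xi>\<^sub>0) + 2 * \<xi> * (1 / \<xi>\<^sub>0)\<^sup>2"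
    using D by (simp add: pos_divide_le_eq mult.commute)
  have c1: "\<bar>(g \<bullet> y) * n\<^sup>2\<bar> \<le> (n * w) * n\<^sup>2"
    unfolding abs_mult using a by (intro mult_mono) auto
  have c2: "\<bar>3/2 * (w\<^sup>2 / (s \<bullet> y)) * n\<^sup>2 * (g \<bullet> s)\<bar> \<le> (3/2 * (w\<^sup>2 / (s \<bullet> y)) * n\<^sup>2) * (n * t)"
    unfolding abs_mult[of _ "g \<bullet> s"] using b sy by (intro mult_mono) (auto simp: abs_mult)
  have "\<bar>C\<bar> \<le> (n * w) * n\<^sup>2 + (3/2 * (w\<^sup>2 / (s \<bullet> y)) * n\<^sup>2) * (n * t)"
    using c1 c2 unfolding C_def by linarith
  \<comment> \<open>\<open>C\<close> is the coefficient of \<open>s\<close>, so it is estimated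
    together with \<open>t = norm s\<close>.\<close>
  hence "\<bar>C\<bar> * t \<le> ((n * w) * n\<^sup>2 + (3/2 * (w\<^sup>2 / (s \<bullet> y)) * n\<^sup>2) * (n * t)) * t"
    using pos by (intro mult_right_mono) auto
  also have "\<dots> = (w\<^sup>2 * n\<^sup>2 / 2) * ((2 * (t / w) + 3 * (t\<^sup>2 / (s \<bullet> y))) * n)"
    using pos sy by (simp add: field_simps power2_eq_square)
  also have "\<dots> \<le> (w\<^sup>2 * n\<^sup>2 / 2) * ((2 * (1 / \<xi>\<^sub>0) + 3 * (1 / \<xi>\<^sub>0)) * n)"
    using q1 q2 pos by (intro mult_left_mono mult_right_mono add_mono) auto
  also have "\<dots> \<le> D * ((2 * (1 / \<xi>\<^sub>0) + 3 * (1 / \<xi>\<^sub>0)) * n)"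
    using Dl pos xi0 by (intro mult_right_mono) auto
  finally have C: "\<bar>C\<bar> * t / D \<le> (5 / \<xi>\<^sub>0) * n"
    using D by (simp add: pos_divide_le_eq mult.commute)
  have "norm (model_dir lam g s y) \<le> \<bar>A\<bar> / D * n + \<bar>C\<bar> * t / D"
    unfolding dir using norm_triangle_ineq[of "(1 / D * A) *\<^sub>R g" "(1 / D * C) *\<^sub>R s"] D
    by (simp add: nd abs_mult abs_divide)
  also have "\<dots> \<le> (4 * (1 / \<xi>\<^sub>0) + 2 * \<xi> * (1 / \<xi>\<^sub>0)\<^sup>2) * n + (5 / \<xi>\<^sub>0) * n"
    using A C pos by (intro add_mono mult_right_mono) auto
  also have "\<dots> = (9 / \<xi>\<^sub>0 + 2 * \<xi> / \<xi>\<^sub>0\<^sup>2) * n"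
    by (simp add: algebra_simps power_divide add_divide_distrib)
  finally show ?thesis by (simp add: nd)
qed

section \<open>First-order inequality for convex functions\<close>

text \<open>Restricting \<open>f\<close> to the line through \<open>z\<close> and \<open>w\<close>
  reduces the claim to the tangent inequality for a convex function of one real variable.\<close>

lemma convex_on_gradient_ineq:
  fixes f :: "'a::real_inner \<Rightarrow> real"
  assumes "convex_on UNIV f" "GDERIV f z :> g"
  shows "f z + g \<bullet> (w - z) \<le> f w"
proof -
  define h where "h = (\<lambda>t::real. f (z + t *\<^sub>R (w - z)))"
  have "convex_on UNIV h"
  proof (intro convex_onI)
    fix t a b :: real assume t: "0 < t" "t < 1"
    have "z + ((1 - t) *\<^sub>R a + t *\<^sub>R b) *\<^sub>R (w - z)
        = (1 - t) *\<^sub>R (z + a *\<^sub>R (w - z)) + t *\<^sub>R (z + b *\<^sub>R (w - z))"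
      by (simp add: algebra_simps)
    thus "h ((1 - t) *\<^sub>R a + t *\<^sub>R b) \<le> (1 - t) * h a + t * h b"
      unfolding h_def using convex_onD[OF assms(1), of t] t by simp
  qed auto
  moreover have "(h has_field_derivative g \<bullet> (w - z)) (at 0 within UNIV)"
  proof -
    have "((\<lambda>t::real. z + t *\<^sub>R (w - z)) has_derivative (\<lambda>t. t *\<^sub>R (w - z))) (at 0)"
      by (auto intro!: derivative_eq_intros)
    moreover have "(f has_derivative (\<lambda>u. u \<bullet> g)) (at (z + 0 *\<^sub>R (w - z)))"
      using assms(2) by (simp add: gderiv_def)
    ultimately have "((\<lambda>t. f (z + t *\<^sub>R (w - z))) has_derivative (\<lambda>t. (t *\<^sub>R (w - z)) \<bullet> g)) (at 0)"
      by (rule has_derivative_compose)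
    thus ?thesis
      by (simp add: h_def has_field_derivative_def inner_commute mult.commute[of "g \<bullet> _"])
         (simp add: mult_commute_abs inner_commute)
  qed
  ultimately have "h 1 - h 0 \<ge> (g \<bullet> (w - z)) * (1 - 0)"
    by (intro convex_on_imp_above_tangent[of UNIV]) auto
  thus ?thesis by (simp add: h_def)
qed

section \<open>Reference values of the line search and the abstract linear rate\<close>

lemma refQ_ge_1: "1 \<le> refQ l F k"
proof (induction k rule: nat_less_induct)
  case (1 k)
  show ?case
  proof (cases k)
    case (Suc j)
    have "1 \<le> refQ l F j" using 1 Suc by simp
    thus ?thesis using Suc by (cases j) (auto simp: Let_def eta_def)
  qed simp
qed

text \<open>Q grows by 1 per step until \<open>l\<close> divides the index, and then it is first
  multiplied by at most 0.999. The bound is an invariant of this cycle: it is at most 1000 l at the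
  end of a period, and 0.999 * 1000 l + 1 = 999 l + 1 starts the next.\<close>

lemma refQ_upper_mod:
  assumes "0 < l"
  shows "refQ l F (Suc k) \<le> 999 * real l + real (k mod l) + 1"
proof (induction k)
  case 0 thus ?case using assms by simp
next
  case (Suc k)
  define Q where "Q = refQ l F (Suc k)"
  define e where "e = eta l (Suc k) (refC l F (Suc k)) (F (Suc (Suc k)))"
  have Q: "1 \<le> Q" unfolding Q_def by (rule refQ_ge_1)
  have R: "refQ l F (Suc (Suc k)) = e * Q + 1" by (simp add: Q_def e_def Let_def)
  show ?case
  proof (cases "l dvd Suc k")
    case True
    have "e \<le> 0.999" using True by (auto simp: e_def eta_def)
    hence "e * Q \<le> 0.999 * Q" using Q by (intro mult_right_mono) auto
    moreover have "k mod l < l" using assms by simp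
    hence "real (k mod l) + 1 \<le> real l" by linarith
    hence "Q \<le> 1000 * real l" using Suc by (simp add: Q_def)
    moreover have "Suc k mod l = 0" using True by auto
    ultimately show ?thesis unfolding R by simp
  next
    case False
    hence "Suc k mod l = Suc (k mod l)" by (metis dvd_eq_mod_eq_0 mod_Suc)
    moreover have "e = 1" using False by (simp add: e_def eta_def)
    ultimately show ?thesis unfolding R using Suc by (simp add: Q_def)
  qed
qed

lemma refQ_upper:
  assumes "0 < l"
  shows "refQ l F (Suc k) \<le> 1000 * real l"
proof -
  have "k mod l < l" using assms by simp
  hence "real (k mod l) + 1 \<le> real l" by linarith
  thus ?thesis using refQ_upper_mod[OF assms, of F k] by simp
qed

text \<open>The update is a convex combination giving the new function value weight 1 / Q. It starts
  at index 2, since C_1 is set by a minimum instead.\<close>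

lemma refC_step:
  "refC l F (Suc (Suc k)) =
     refC l F (Suc k) - (refC l F (Suc k) - F (Suc (Suc k))) / refQ l F (Suc (Suc k))"
proof -
  define e C Q F' where "e = eta l (Suc k) (refC l F (Suc k)) (F (Suc (Suc k)))"
    and "C = refC l F (Suc k)" and "Q = refQ l F (Suc k)" and "F' = F (Suc (Suc k))"
  note defs = this
  have Q: "refQ l F (Suc (Suc k)) = e * Q + 1" by (simp add: defs Let_def)
  moreover have "refC l F (Suc (Suc k)) = (e * Q * C + F') / (e * Q + 1)"
    by (simp add: defs Let_def)
  moreover have "0 < e * Q + 1" using refQ_ge_1[of l F "Suc (Suc k)"] unfolding Q by linarith
  hence "(e * Q * C + F') / (e * Q + 1) = C - (C - F') / (e * Q + 1)"
    by (simp add: divide_simps) (simp add: algebra_simps)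
  ultimately show ?thesis unfolding defs(2,4) by metis
qed

text \<open>From the second update on, the reference value moves towards the new function value by a
  fraction 1 / Q in (0, 1]; the first update is read off from the minimum.\<close>

lemma refC_Suc_le:
  assumes "F (Suc k) \<le> refC l F k"
  shows "F (Suc k) \<le> refC l F (Suc k)" "refC l F (Suc k) \<le> refC l F k"
proof -
  have "F (Suc k) \<le> refC l F (Suc k) \<and> refC l F (Suc k) \<le> refC l F k"
  proof (cases k)
    case 0
    thus ?thesis using assms by auto
  next
    case (Suc j)
    have Q: "1 \<le> refQ l F (Suc k)" by (rule refQ_ge_1)
    have "0 \<le> (refC l F k - F (Suc k)) / refQ l F (Suc k)" using assms Q by simp
    moreover have "(refC l F k - F (Suc k)) / refQ l F (Suc k) \<le> refC l F k - F (Suc k)"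
      using Q assms mult_left_mono[OF Q, of "refC l F k - F (Suc k)"] by (simp add: field_simps)
    ultimately show ?thesis using refC_step[of l F j] Suc by simp
  qed
  thus "F (Suc k) \<le> refC l F (Suc k)" "refC l F (Suc k) \<le> refC l F k" by auto
qed

text \<open>The reference value need not decrease from \<open>C\<^sub>0\<close> to \<open>C\<^sub>1\<close>; the lost factor is regained by taking
  a square root of the contraction factor.\<close>

lemma refC_linear_rate:
  fixes F :: "nat \<Rightarrow> real"
  assumes l: "0 < l" and c: "0 < c" and min: "\<And>k. Fmin \<le> F k"
    and decrease: "\<And>k. c * (F (Suc k) - Fmin) \<le> refC l F k - F (Suc k)"
  shows "\<exists>\<theta>. 0 < \<theta> \<and> \<theta> < 1 \<and> (\<forall>k. F k - Fmin \<le> \<theta> ^ k * (F 0 - Fmin))"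
proof -
  \<comment> \<open>Solving \<open>decrease\<close> for the new function gap bounds it by \<phi>
    times the reference gap.\<close>
  define \<phi> where "\<phi> = 1 / (1 + c)"
  define M where "M = 1000 * real l"
  \<comment> \<open>The reference gap loses at least the fraction (1 - \<phi>) / Q per step, and Q
    \<le> M.\<close>
  define \<psi> where "\<psi> = 1 - (1 - \<phi>) / M"
  define C where "C k = refC l F k - Fmin" for k
  have phi: "0 < \<phi>" "\<phi> < 1" using c by (auto simp: \<phi>_def)
  have M: "1 < M" using l by (simp add: M_def)
  have psi: "\<phi> \<le> \<psi>" "\<psi> < 1"
    using phi M mult_left_mono[of 1 M "1 - \<phi>"] by (auto simp: \<psi>_def field_simps)
  have F: "F (Suc k) - Fmin \<le> \<phi> * C k" for k
    using decrease[of k] c by (simp add: \<phi>_def C_def field_simps)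
  have le: "F (Suc k) \<le> refC l F k" for k
    using decrease[of k] c min[of "Suc k"]
    by (smt (verit) mult_nonneg_nonneg)
  have C0: "0 \<le> C 0" using min[of 0] by (simp add: C_def)
  have rate: "C (Suc k) \<le> \<psi> ^ k * C 0" for k
  proof (induction k)
    case 0
    show ?case using refC_Suc_le(2)[OF le, of 0] by (simp add: C_def)
  next
    case (Suc k)
    define q where "q = refQ l F (Suc (Suc k))"
    have q: "0 < q" "q \<le> M"
      using refQ_ge_1[of l F "Suc (Suc k)"] refQ_upper[OF l, of F "Suc k"] by (auto simp: q_def M_def)
    have Cn: "0 \<le> C (Suc k)"
      using refC_Suc_le(1)[OF le, of k] min[of "Suc k"] by (simp add: C_def)
    have "(1 - \<phi>) * C (Suc k) \<le> refC l F (Suc k) - F (Suc (Suc k))"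
      using F[of "Suc k"] by (simp add: C_def algebra_simps)
    hence "(1 - \<phi>) * C (Suc k) / M \<le> (refC l F (Suc k) - F (Suc (Suc k))) / q"
      using q phi Cn by (intro frac_le) (auto simp: le)
    moreover have "C (Suc (Suc k)) = C (Suc k) - (refC l F (Suc k) - F (Suc (Suc k))) / q"
      using refC_step[of l F k] unfolding C_def q_def by linarith
    moreover have "\<psi> * C (Suc k) = C (Suc k) - (1 - \<phi>) * C (Suc k) / M"
      by (simp add: \<psi>_def left_diff_distrib)
    ultimately have "C (Suc (Suc k)) \<le> \<psi> * C (Suc k)" by linarith
    also have "\<dots> \<le> \<psi> * (\<psi> ^ k * C 0)"
      using Suc phi psi by (intro mult_left_mono) auto
    finally show ?case by simp
  qed
  define \<theta> where "\<theta> = sqrt \<psi>"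
  have th: "0 < \<theta>" "\<theta> < 1" "\<theta>\<^sup>2 = \<psi>" using phi psi by (auto simp: \<theta>_def)
  have "F k - Fmin \<le> \<theta> ^ k * (F 0 - Fmin)" for k
  proof -
    consider "k = 0" | "k = 1" | j where "k = Suc (Suc j)" by (metis One_nat_def not0_implies_Suc)
    thus ?thesis
    proof cases
      case 2
      \<comment> \<open>\<phi> \<le> \<psi> = \<theta>^2 \<le> \<theta>.\<close>
      have "\<phi> \<le> \<theta>" using psi th power_le_one_iff[of \<theta> 2]
        by (smt (verit) mult_left_le_one_le power2_eq_square)
      hence "\<phi> * C 0 \<le> \<theta> * C 0" using C0 by (rule mult_right_mono)
      thus ?thesis using F[of 0] 2 by (simp add: C_def)
    next
      case 3
      have "F k - Fmin \<le> \<phi> * (\<psi> ^ j * C 0)"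
        unfolding 3 by (rule order_trans[OF F mult_left_mono[OF rate less_imp_le[OF phi(1)]]])
      also have "\<dots> \<le> \<psi> * (\<psi> ^ j * C 0)"
        using psi phi C0 by (intro mult_right_mono) auto
      \<comment> \<open>The available exponent 2 (j + 1) is at least the required k = j + 2.\<close>
      also have "\<dots> = \<theta> ^ (2 * Suc j) * C 0" unfolding power_mult th(3) by simp
      also have "\<dots> \<le> \<theta> ^ k * C 0"
        using th 3 C0 by (intro mult_right_mono power_decreasing) auto
      finally show ?thesis by (simp add: C_def)
    qed simp
  qed
  thus ?thesis using th by blast
qed

section \<open>Search directions of the method: case analysis and uniform bounds\<close>

lemma quad_dir_eq_model_dir:
  "quad_dir g x (Suc j) = model_dir 0 (g (x (Suc j))) (x (Suc j) - x j) (g (x (Suc j)) - g (x j))"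
proof -
  define G s y where "G = g (x (Suc j))" and "s = x (Suc j) - x j" and "y = G - g (x j)"
  note defs = this
  have "det (Bmat g x (Suc j)) = model_denom 0 G s y"
    unfolding Bmat_def rho_def model_denom_def det_2 defs vector_2 diff_Suc_1
    by (simp only: mult_zero_left add_0_right power2_eq_square)
  thus ?thesis
    unfolding quad_dir_def mu_bar_def nu_bar_def rho_def model_dir_def diff_Suc_1
    by (simp only: defs mult_zero_left add_0_right diff_zero)
qed

lemma reg_dir_PR2_eq_model_dir:
  "reg_dir_PR2 p f g x (Suc j) =
     model_dir (lambda_PR2 p f g x (Suc j)) (g (x (Suc j))) (x (Suc j) - x j)
       (g (x (Suc j)) - g (x j))"
  unfolding reg_dir_PR2_def mu_hat_def nu_hat_def Delta_bar_def rho_def model_dir_def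
    model_denom_def diff_Suc_1
  by (rule refl)

text \<open>Only the truncations by \<open>min\<close> matter for the two regularized directions, not the roots \<open>z\<^sup>*\<close>.\<close>

lemma direction_cases:
  fixes g :: "real^'n \<Rightarrow> real^'n" and x :: "nat \<Rightarrow> real^'n"
  defines "s \<equiv> \<lambda>j. x (Suc j) - x j" and "y \<equiv> \<lambda>j. g (x (Suc j)) - g (x j)"
  assumes p: "0 \<le> p" and sy: "0 < s j \<bullet> y j"
  obtains
    (steepest) "direction p \<xi>\<^sub>1 \<xi>\<^sub>2 \<xi>\<^sub>3 \<xi>\<^sub>4 \<xi>\<^sub>5 \<tau>\<^sub>1 \<tau>\<^sub>2 \<gamma> MaxRestart MinQuad f g x v d (Suc j)
      = - g (x (Suc j))"
  | (model) c lam where "1/2 \<le> c" "c \<le> 1" "0 \<le> lam" "lam \<le> (norm (y j))\<^sup>2 / (s j \<bullet> y j)"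
      "testW \<xi>\<^sub>1 \<xi>\<^sub>2 g x (Suc j)"
      "direction p \<xi>\<^sub>1 \<xi>\<^sub>2 \<xi>\<^sub>3 \<xi>\<^sub>4 \<xi>\<^sub>5 \<tau>\<^sub>1 \<tau>\<^sub>2 \<gamma> MaxRestart MinQuad f g x v d (Suc j)
      = c *\<^sub>R model_dir lam (g (x (Suc j))) (s j) (y j)"
  | (hestenes_stiefel) "testS \<xi>\<^sub>1 \<xi>\<^sub>3 g x (Suc j)"
      "direction p \<xi>\<^sub>1 \<xi>\<^sub>2 \<xi>\<^sub>3 \<xi>\<^sub>4 \<xi>\<^sub>5 \<tau>\<^sub>1 \<tau>\<^sub>2 \<gamma> MaxRestart MinQuad f g x v d (Suc j)
      = - g (x (Suc j)) + ((g (x (Suc j)) \<bullet> y j) / (d j \<bullet> y j)) *\<^sub>R d j"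
proof -
  define cb where "cb = choose_branch \<xi>\<^sub>1 \<xi>\<^sub>2 \<xi>\<^sub>3 \<tau>\<^sub>1 \<tau>\<^sub>2 \<gamma> MaxRestart MinQuad f g x (Suc j)
    (count \<xi>\<^sub>4 \<xi>\<^sub>5 f g x (Suc j) (counters \<xi>\<^sub>1 \<xi>\<^sub>2 \<xi>\<^sub>3 \<xi>\<^sub>4 \<xi>\<^sub>5 \<tau>\<^sub>1 \<tau>\<^sub>2 \<gamma> MaxRestart MinQuad f g x j))"
  have W: "testW \<xi>\<^sub>1 \<xi>\<^sub>2 g x (Suc j)" if "cb = Quadratic \<or> cb = Regularized"
    using that by (auto simp: cb_def choose_branch_def split: prod.splits if_splits)
  have S: "testS \<xi>\<^sub>1 \<xi>\<^sub>3 g x (Suc j)" if "cb = Hestenes_Stiefel"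
    using that by (auto simp: cb_def choose_branch_def split: prod.splits if_splits)
  have q: "0 \<le> (norm (y j))\<^sup>2 / (s j \<bullet> y j)" using sy by simp
  show thesis
  proof (cases cb)
    case Steepest
    thus ?thesis by (intro steepest) (simp add: direction_def cb_def[symmetric])
  next
    case Quadratic
    show ?thesis
      by (rule model[of 1 0])
         (use Quadratic W q in \<open>auto simp: direction_def cb_def[symmetric] quad_dir_eq_model_dir s_def y_def\<close>)
  next
    case Hestenes_Stiefel
    thus ?thesis using S
      by (intro hestenes_stiefel) (auto simp: direction_def cb_def[symmetric] y_def)
  next
    case Regularized
    show ?thesis
    proof (cases v)
      case PR1
      define w where "w = min (sigma_PR1 p f g x (Suc j) * z_PR1 p f g x (Suc j) powr (p - 2)) 1"
      \<comment> \<open>\<open>powr\<close> is nonnegative for all arguments, so \<open>w\<close>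
        lies in [0, 1] whatever value the description \<open>z_PR1\<close> denotes; then 1 / (1 + w)
        lies in [1/2, 1].\<close>
      have "0 \<le> sigma_PR1 p f g x (Suc j)" using p by (simp add: sigma_PR1_def)
      hence w: "0 \<le> w" "w \<le> 1" by (auto simp: w_def)
      show ?thesis
        by (rule model[of "1 / (1 + w)" 0])
           (use Regularized PR1 W q w in \<open>auto simp: direction_def cb_def[symmetric]
              reg_dir_PR1_def w_def[symmetric] quad_dir_eq_model_dir s_def y_def field_simps\<close>)
    next
      case PR2
      have "0 \<le> sigma_PR2 p f g x (Suc j)" using p by (simp add: sigma_PR2_def)
      hence lam: "0 \<le> lambda_PR2 p f g x (Suc j)"
        "lambda_PR2 p f g x (Suc j) \<le> (norm (y j))\<^sup>2 / (s j \<bullet> y j)"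
        using q by (auto simp: lambda_PR2_def s_def y_def)
      show ?thesis
        by (rule model[of 1 "lambda_PR2 p f g x (Suc j)"])
           (use Regularized PR2 W lam in \<open>auto simp: direction_def cb_def[symmetric]
              reg_dir_PR2_eq_model_dir s_def y_def\<close>)
    qed
  qed
qed

text \<open>The constants cover all branches at once: a minimum of the descent constants and a sum
  of the norm constants. The Lipschitz estimate is a premise of the norm bound alone, because
  descent must be available before the iterates are known to stay in \<Theta>.\<close>

lemma direction_bounds:
  fixes g :: "real^'n \<Rightarrow> real^'n" and x :: "nat \<Rightarrow> real^'n"
  defines "s \<equiv> \<lambda>j. x (Suc j) - x j" and "y \<equiv> \<lambda>j. g (x (Suc j)) - g (x j)"
  assumes p: "0 \<le> p" and sy: "0 < s j \<bullet> y j" and g0: "g (x (Suc j)) \<noteq> 0"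
    and xi: "0 < \<xi>\<^sub>1" "0 < \<xi>\<^sub>2" "0 < \<xi>\<^sub>3" "\<xi>\<^sub>3 < 1"
    and step: "s j = a *\<^sub>R d j"
    and dk: "dk = direction p \<xi>\<^sub>1 \<xi>\<^sub>2 \<xi>\<^sub>3 \<xi>\<^sub>4 \<xi>\<^sub>5 \<tau>\<^sub>1 \<tau>\<^sub>2 \<gamma> MaxRestart MinQuad f g x v d (Suc j)"
  shows "g (x (Suc j)) \<bullet> dk \<le> - min (1 - \<xi>\<^sub>3) (1 / (5 * \<xi>\<^sub>2)) * (norm (g (x (Suc j))))\<^sup>2" (is ?descent)
    and "norm (y j) \<le> L * norm (s j) \<Longrightarrow> 0 \<le> L \<Longrightarrow>
      norm dk \<le> (1 + L / \<xi>\<^sub>1 + 9 / \<xi>\<^sub>1 + 2 * \<xi>\<^sub>2 / \<xi>\<^sub>1\<^sup>2) * norm (g (x (Suc j)))"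
      (is "_ \<Longrightarrow> _ \<Longrightarrow> ?bounded")
proof -
  define G where "G = g (x (Suc j))"
  define c where "c = min (1 - \<xi>\<^sub>3) (1 / (5 * \<xi>\<^sub>2))"
  define K where "K = 1 + L / \<xi>\<^sub>1 + 9 / \<xi>\<^sub>1 + 2 * \<xi>\<^sub>2 / \<xi>\<^sub>1\<^sup>2"
  have c: "c \<le> 1 - \<xi>\<^sub>3" "c \<le> 1 / (5 * \<xi>\<^sub>2)" by (auto simp: c_def)
  have s0: "0 < (norm (s j))\<^sup>2" using sy by auto
  have descentI: "?descent" if "G \<bullet> dk \<le> - (c' * (norm G)\<^sup>2)" "c \<le> c'" for c'
  proof -
    have "c * (norm G)\<^sup>2 \<le> c' * (norm G)\<^sup>2" using that(2) by (intro mult_right_mono) auto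
    thus ?thesis using that(1) unfolding G_def[symmetric] c_def[symmetric] by simp
  qed
  have boundedI: "?bounded" if "norm dk \<le> K' * norm G" "K' \<le> K" for K'
  proof -
    have "K' * norm G \<le> K * norm G" using that(2) by (intro mult_right_mono) auto
    thus ?thesis using that(1) unfolding G_def[symmetric] K_def[symmetric] by simp
  qed
  have "?descent \<and> (norm (y j) \<le> L * norm (s j) \<longrightarrow> 0 \<le> L \<longrightarrow> ?bounded)"
    using p sy[unfolded s_def y_def]
  proof (cases rule: direction_cases[where \<xi>\<^sub>1 = \<xi>\<^sub>1 and \<xi>\<^sub>2 = \<xi>\<^sub>2 and \<xi>\<^sub>3 = \<xi>\<^sub>3 and \<xi>\<^sub>4 = \<xi>\<^sub>4 and \<xi>\<^sub>5 = \<xi>\<^sub>5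
        and \<tau>\<^sub>1 = \<tau>\<^sub>1 and \<tau>\<^sub>2 = \<tau>\<^sub>2 and \<gamma> = \<gamma> and MaxRestart = MaxRestart and MinQuad = MinQuad
        and f = f and v = v and d = d])
    case steepest
    hence "dk = - G" by (simp add: dk G_def)
    thus ?thesis
      using descentI[of 1] boundedI[of 1] c xi by (auto simp: power2_norm_eq_inner K_def)
  next
    case (model t lam)
    have W: "\<xi>\<^sub>1 * (norm (s j))\<^sup>2 \<le> s j \<bullet> y j" "(norm (y j))\<^sup>2 / (s j \<bullet> y j) \<le> \<xi>\<^sub>2"
      using model(5) s0 by (auto simp: testW_def s_def y_def pos_le_divide_eq)
    have lam: "lam \<le> \<xi>\<^sub>2" using model(4) W(2) by (simp add: s_def y_def)
    define m where "m = model_dir lam G (s j) (y j)"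
    have dk: "dk = t *\<^sub>R m" using model(6) by (simp add: dk m_def G_def s_def y_def)
    have "G \<bullet> m \<le> - (2 / (5 * \<xi>\<^sub>2)) * (norm G)\<^sup>2"
      unfolding m_def using model_dir_descent[OF sy model(3) lam W(2) _ xi(2), of G] g0
      by (simp add: G_def)
    hence "t * (G \<bullet> m) \<le> t * (- (2 / (5 * \<xi>\<^sub>2)) * (norm G)\<^sup>2)"
      using model(1) by (intro mult_left_mono) auto
    also have "\<dots> = - (t * (2 / (5 * \<xi>\<^sub>2))) * (norm G)\<^sup>2" by simp
    finally have "G \<bullet> dk \<le> - (t * (2 / (5 * \<xi>\<^sub>2)) * (norm G)\<^sup>2)" by (simp add: dk)
    \<comment> \<open>The scaling factor \<open>t \<ge> 1/2\<close> halves the model constant,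
      giving \<open>1 / (5 * \<xi>\<^sub>2)\<close>.\<close>
    moreover have "1/2 * (2 / (5 * \<xi>\<^sub>2)) \<le> t * (2 / (5 * \<xi>\<^sub>2))"
      using model(1) xi by (intro mult_right_mono) auto
    ultimately have ?descent using c by (intro descentI[of "t * (2 / (5 * \<xi>\<^sub>2))"]) auto
    moreover have ?bounded if "0 \<le> L"
    proof (rule boundedI)
      have "norm dk = t * norm m" using model(1) by (simp add: dk)
      also have "\<dots> \<le> 1 * norm m" using model(1,2) by (intro mult_right_mono) auto
      also have "\<dots> \<le> (9 / \<xi>\<^sub>1 + 2 * \<xi>\<^sub>2 / \<xi>\<^sub>1\<^sup>2) * norm G"
        unfolding m_def using model_dir_norm[OF sy model(3) lam xi(1) W(1), of G] g0
        by (simp add: G_def)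
      finally show "norm dk \<le> (9 / \<xi>\<^sub>1 + 2 * \<xi>\<^sub>2 / \<xi>\<^sub>1\<^sup>2) * norm G" .
      have "0 \<le> L / \<xi>\<^sub>1" using that xi by simp
      thus "9 / \<xi>\<^sub>1 + 2 * \<xi>\<^sub>2 / \<xi>\<^sub>1\<^sup>2 \<le> K" by (simp add: K_def)
    qed
    ultimately show ?thesis by blast
  next
    case hestenes_stiefel
    have S: "\<xi>\<^sub>1 * (norm (s j))\<^sup>2 \<le> s j \<bullet> y j"
      "\<bar>(G \<bullet> y j) * (G \<bullet> s j)\<bar> / ((s j \<bullet> y j) * (norm G)\<^sup>2) \<le> \<xi>\<^sub>3"
      using hestenes_stiefel(1) s0 by (auto simp: testS_def s_def y_def G_def pos_le_divide_eq)
    \<comment> \<open>The Hestenes-Stiefel term is invariant under nonzero scaling of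
      \<open>d j\<close>, so it can be written with \<open>s j\<close>, the vector that test (S)
      controls.\<close>
    have "a \<noteq> 0" using sy step by auto
    hence "((G \<bullet> y j) / (d j \<bullet> y j)) *\<^sub>R d j = ((G \<bullet> y j) / (s j \<bullet> y j)) *\<^sub>R s j"
      by (simp add: step)
    hence dk: "dk = - G + ((G \<bullet> y j) / (s j \<bullet> y j)) *\<^sub>R s j"
      using hestenes_stiefel(2) by (simp add: dk G_def y_def)
    have "0 < (norm G)\<^sup>2" using g0 by (simp add: G_def)
    hence "\<bar>(G \<bullet> y j) * (G \<bullet> s j)\<bar> \<le> \<xi>\<^sub>3 * ((s j \<bullet> y j) * (norm G)\<^sup>2)"
      using S(2) sy by (simp add: pos_divide_le_eq)
    hence "(G \<bullet> y j) * (G \<bullet> s j) / (s j \<bullet> y j) \<le> \<xi>\<^sub>3 * (norm G)\<^sup>2"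
      using sy by (simp add: pos_divide_le_eq algebra_simps)
    hence "G \<bullet> dk \<le> - ((1 - \<xi>\<^sub>3) * (norm G)\<^sup>2)"
      by (simp add: dk inner_add_right algebra_simps power2_norm_eq_inner)
    hence ?descent using c by (intro descentI) auto
    moreover have ?bounded if L: "norm (y j) \<le> L * norm (s j)" "0 \<le> L"
    proof (rule boundedI)
      \<comment> \<open>The Lipschitz estimate produces \<parallel>s\<parallel>^2, which the
        curvature part of (S) bounds by \<open>(s j \<bullet> y j) / \<xi>\<^sub>1\<close>.\<close>
      have "\<bar>G \<bullet> y j\<bar> * norm (s j) \<le> (norm G * (L * norm (s j))) * norm (s j)"
        by (intro mult_right_mono order_trans[OF Cauchy_Schwarz_ineq2] mult_left_mono L(1)) auto
      also have "\<dots> = (L * norm G) * (norm (s j))\<^sup>2" by (simp add: power2_eq_square)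
      also have "\<dots> \<le> (L * norm G) * ((s j \<bullet> y j) / \<xi>\<^sub>1)"
        using S(1) L(2) xi by (intro mult_left_mono) (auto simp: pos_le_divide_eq mult.commute)
      finally have "\<bar>G \<bullet> y j\<bar> * norm (s j) / (s j \<bullet> y j) \<le> L / \<xi>\<^sub>1 * norm G"
        using sy by (simp add: pos_divide_le_eq algebra_simps)
      moreover have "norm dk \<le> norm G + \<bar>G \<bullet> y j\<bar> * norm (s j) / (s j \<bullet> y j)"
        unfolding dk using norm_triangle_ineq[of "- G" "((G \<bullet> y j) / (s j \<bullet> y j)) *\<^sub>R s j"] sy
        by (simp add: abs_divide)
      ultimately show "norm dk \<le> (1 + L / \<xi>\<^sub>1) * norm G" by (simp add: algebra_simps)
      show "1 + L / \<xi>\<^sub>1 \<le> K" using xi by (simp add: K_def)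
    qed
    ultimately show ?thesis by blast
  qed
  thus ?descent "norm (y j) \<le> L * norm (s j) \<Longrightarrow> 0 \<le> L \<Longrightarrow> ?bounded" by auto
qed

section \<open>Linear convergence of the function values\<close>

theorem theorem5p4:
  fixes f :: "real^'n \<Rightarrow> real" and g :: "real^'n \<Rightarrow> real^'n"
    and x d :: "nat \<Rightarrow> real^'n" and \<alpha> :: "nat \<Rightarrow> real" and xstar :: "real^'n"
    and p \<delta> \<sigma> \<xi>\<^sub>1 \<xi>\<^sub>2 \<xi>\<^sub>3 \<xi>\<^sub>4 \<xi>\<^sub>5 \<tau>\<^sub>1 \<tau>\<^sub>2 \<gamma> :: real
    and MaxRestart MinQuad :: nat
    and L \<kappa> \<alpha>bar :: real and \<Theta> :: "(real^'n) set" and v :: variant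
  assumes "p > 2" and "0 < \<delta>" and "\<delta> < \<sigma>" and "\<sigma> < 1"
    and "\<xi>\<^sub>1 > 0" and "\<xi>\<^sub>2 > 0" and "0 < \<xi>\<^sub>3" and "\<xi>\<^sub>3 < 1" and "\<xi>\<^sub>4 > 0" and "\<xi>\<^sub>5 > 0"
    and "\<tau>\<^sub>1 > 0" and "\<tau>\<^sub>2 > 0" and "0 < \<gamma>" and "\<gamma> < 1"
    and "MaxRestart > 0" and "MinQuad > 0"
    and gradient: "\<And>z. GDERIV f z :> g z" and C1: "continuous_on UNIV g"
    and convex: "convex_on UNIV f"
    and minimizer: "is_arg_min f (\<lambda>_. True) xstar"
    and lipschitz: "open \<Theta>" "{z. f z \<le> f (x 0)} \<subseteq> \<Theta>" "L > 0" "L-lipschitz_on \<Theta> g"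
    and error_bound: "\<kappa> > 0"
      "\<And>z. norm (g z) \<ge> \<kappa> * norm (z - closest_point {w. is_arg_min f (\<lambda>_. True) w} z)"
    and generated: "SMCG_PR p \<delta> \<sigma> \<xi>\<^sub>1 \<xi>\<^sub>2 \<xi>\<^sub>3 \<xi>\<^sub>4 \<xi>\<^sub>5 \<tau>\<^sub>1 \<tau>\<^sub>2 \<gamma> MaxRestart MinQuad f g x v d \<alpha>"
    and stepsizes: "\<alpha>bar > 0" "\<And>k. \<alpha> k \<le> \<alpha>bar"
    and "\<And>k. norm (g (x k)) \<noteq> 0"
  shows "\<exists>\<theta>. 0 < \<theta> \<and> \<theta> < 1 \<and> (\<forall>k. f (x k) - f xstar \<le> \<theta> ^ k * (f (x 0) - f xstar))"
proof -
  define l where "l = max 20 CARD('n)"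
  define c where "c = min (1 - \<xi>\<^sub>3) (1 / (5 * \<xi>\<^sub>2))"
  define K where "K = 1 + L / \<xi>\<^sub>1 + 9 / \<xi>\<^sub>1 + 2 * \<xi>\<^sub>2 / \<xi>\<^sub>1\<^sup>2"
  define F where "F k = f (x k)" for k
  define G where "G k = g (x k)" for k
  define s where "s k = x (Suc k) - x k" for k
  define y where "y k = G (Suc k) - G k" for k
  note params = assms(1-16)
  have c: "0 < c" "c \<le> 1" using params by (auto simp: c_def)
  have K: "1 \<le> K" using params lipschitz(3) by (auto simp: K_def)
  have d0: "d 0 = - G 0"
    and dS: "d (Suc k) = direction p \<xi>\<^sub>1 \<xi>\<^sub>2 \<xi>\<^sub>3 \<xi>\<^sub>4 \<xi>\<^sub>5 \<tau>\<^sub>1 \<tau>\<^sub>2 \<gamma> MaxRestart MinQuad f g x v d (Suc k)"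
    and step: "s k = \<alpha> k *\<^sub>R d k" and \<alpha>: "0 < \<alpha> k"
    and armijo: "F (Suc k) \<le> refC l F k + \<delta> * \<alpha> k * (G k \<bullet> d k)"
    and curvature: "\<sigma> * (G k \<bullet> d k) \<le> G (Suc k) \<bullet> d k" for k
    using generated unfolding SMCG_PR_def s_def G_def F_def[abs_def] l_def by auto
  have G0: "G k \<noteq> 0" for k using assms(30)[of k] by (auto simp: G_def)
  have sy_of_descent: "0 < s k \<bullet> y k" if "G k \<bullet> d k < 0" for k
  proof -
    have "0 < (\<sigma> - 1) * (G k \<bullet> d k)" using that params by (simp add: mult_neg_neg)
    also have "\<dots> \<le> d k \<bullet> y k"
      using curvature[of k] by (simp add: y_def inner_diff_right inner_commute algebra_simps)
    finally show ?thesis using \<alpha>[of k] by (simp add: step)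
  qed
  have neg: "G k \<bullet> d k < 0" if "G k \<bullet> d k \<le> - c * (norm (G k))\<^sup>2" for k
  proof -
    have "0 < c * (norm (G k))\<^sup>2" using c G0[of k] by simp
    thus ?thesis using that by simp
  qed
  \<comment> \<open>Descent and positive curvature are interleaved: descent at k yields s_k
    \<bullet> y_k > 0 by the Wolfe curvature condition, and this makes the direction bounds
    applicable at k + 1.\<close>
  have descent: "G k \<bullet> d k \<le> - c * (norm (G k))\<^sup>2" for k
  proof (induction k)
    case 0
    show ?case using mult_right_mono[OF c(2), of "(norm (G 0))\<^sup>2"]
      by (simp add: d0 power2_norm_eq_inner)
  next
    case (Suc k)
    show ?case
      using direction_bounds(1)[of p x k g, OF _ _ _ _ _ _ _ step[unfolded s_def] dS]
        sy_of_descent[OF neg[OF Suc]] params G0[of "Suc k"]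
      by (simp add: s_def y_def G_def c_def)
  qed
  have sy: "0 < s k \<bullet> y k" for k using sy_of_descent neg descent by blast
  have decrease: "\<delta> * \<alpha> k * c * (norm (G k))\<^sup>2 \<le> refC l F k - F (Suc k)" for k
  proof -
    have "\<delta> * \<alpha> k * (G k \<bullet> d k) \<le> \<delta> * \<alpha> k * (- c * (norm (G k))\<^sup>2)"
      using descent[of k] \<alpha>[of k] params by (intro mult_left_mono) auto
    thus ?thesis using armijo[of k] by simp
  qed
  have F_le: "F (Suc k) \<le> refC l F k" for k
  proof -
    have "0 \<le> \<delta> * \<alpha> k * c * (norm (G k))\<^sup>2" using \<alpha>[of k] params c by simp
    thus ?thesis using decrease[of k] by linarith
  qed
  \<comment> \<open>Since C_k never rises above C_0 = F_0, all iterates stay in the initial level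
    set, where the Lipschitz bound holds.\<close>
  have "refC l F k \<le> F 0 \<and> F k \<le> F 0" for k
  proof (induction k)
    case (Suc k)
    thus ?case using refC_Suc_le(2)[where F = F and l = l, OF F_le[of k]] F_le[of k] by linarith
  qed simp
  hence inTheta: "x k \<in> \<Theta>" for k using lipschitz(2) by (auto simp: F_def)
  have lip: "norm (y k) \<le> L * norm (s k)" for k
    using lipschitz_onD[OF lipschitz(4) inTheta[of "Suc k"] inTheta[of k]]
    by (simp add: y_def s_def G_def dist_norm)
  have bounded: "norm (d k) \<le> K * norm (G k)" for k
  proof (cases k)
    case 0
    thus ?thesis using mult_right_mono[OF K, of "norm (G 0)"] by (simp add: d0)
  next
    case (Suc j)
    show ?thesis
      using direction_bounds(2)[of p x j g, OF _ _ _ _ _ _ _ step[unfolded s_def] dS, of L]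
        sy[of j] lip[of j] params lipschitz(3) G0[of k]
      by (simp add: Suc s_def y_def G_def K_def)
  qed
  \<comment> \<open>Lower bound for the stepsizes, from (1 - \<sigma>) c \<parallel>G\<parallel>^2
    \<le> y \<bullet> d \<le> \<alpha> L \<parallel>d\<parallel>^2 \<le> \<alpha> L K^2
    \<parallel>G\<parallel>^2.\<close>
  define a where "a = (1 - \<sigma>) * c / (L * K\<^sup>2)"
  have a: "0 < a" using params c K lipschitz(3) by (simp add: a_def)
  have a_le: "a \<le> \<alpha> k" for k
  proof -
    have n: "0 < (norm (G k))\<^sup>2" using G0[of k] by simp
    have "(1 - \<sigma>) * (c * (norm (G k))\<^sup>2) \<le> (1 - \<sigma>) * (- (G k \<bullet> d k))"
      using descent[of k] params by (intro mult_left_mono) auto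
    also have "\<dots> \<le> y k \<bullet> d k"
      using curvature[of k] by (simp add: y_def inner_diff_left algebra_simps)
    also have "\<dots> \<le> norm (y k) * norm (d k)" by (rule norm_cauchy_schwarz)
    also have "\<dots> \<le> (L * (\<alpha> k * norm (d k))) * norm (d k)"
      using lip[of k] \<alpha>[of k] by (intro mult_right_mono) (auto simp: step)
    also have "\<dots> = (L * \<alpha> k) * (norm (d k))\<^sup>2" by (simp add: power2_eq_square)
    also have "\<dots> \<le> (L * \<alpha> k) * (K * norm (G k))\<^sup>2"
      using bounded[of k] \<alpha>[of k] lipschitz(3) by (intro mult_left_mono power_mono) auto
    also have "\<dots> = (\<alpha> k * (L * K\<^sup>2)) * (norm (G k))\<^sup>2" by (simp add: power_mult_distrib)
    finally have "(1 - \<sigma>) * c \<le> \<alpha> k * (L * K\<^sup>2)"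
      using n by (simp add: mult.assoc[symmetric])
    thus ?thesis using lipschitz(3) K by (simp add: a_def pos_divide_le_eq)
  qed
  \<comment> \<open>Growth factor of the gradient norm over one step of length at most
    \<open>\<alpha>bar * norm (d k)\<close>.\<close>
  define H where "H = 1 + L * \<alpha>bar * K"
  have H: "1 \<le> H" using lipschitz(3) stepsizes(1) K by (simp add: H_def)
  have G_next: "norm (G (Suc k)) \<le> H * norm (G k)" for k
  proof -
    have "norm (G (Suc k)) \<le> norm (G k) + norm (y k)"
      using norm_triangle_ineq[of "G k" "y k"] by (simp add: y_def)
    also have "norm (y k) \<le> L * (\<alpha> k * norm (d k))" using lip[of k] \<alpha>[of k] by (simp add: step)
    also have "\<dots> \<le> L * (\<alpha>bar * (K * norm (G k)))"
      using stepsizes \<alpha>[of k] bounded[of k] lipschitz(3)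
      by (intro mult_left_mono mult_mono) auto
    finally show ?thesis by (simp add: H_def algebra_simps)
  qed
  have isCont: "isCont f z" for z
    using gradient[of z] unfolding gderiv_def by (rule has_derivative_continuous)
  have argmin: "{w. is_arg_min f (\<lambda>_. True) w} = {w. f w \<le> f xstar}"
    using minimizer by (auto simp: is_arg_min_linorder intro: order_trans)
  \<comment> \<open>Closedness, with \<open>xstar\<close> as a member, ensures that
    \<open>closest_point\<close> really returns a minimizer.\<close>
  have "closed {w. f w \<le> f xstar}"
    using isCont by (intro closed_Collect_le continuous_intros)
      (auto simp: continuous_on_eq_continuous_at)
  hence proj: "f (closest_point {w. is_arg_min f (\<lambda>_. True) w} z) \<le> f xstar" for z
    using closest_point_in_set[of "{w. f w \<le> f xstar}" z] unfolding argmin by auto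
  have gap: "F k - f xstar \<le> (norm (G k))\<^sup>2 / \<kappa>" for k
  proof -
    define w where "w = closest_point {w. is_arg_min f (\<lambda>_. True) w} (x k)"
    have "F k - f xstar \<le> F k - f w" using proj[of "x k"] by (simp add: w_def)
    also have "\<dots> \<le> G k \<bullet> (x k - w)"
      using convex_on_gradient_ineq[OF convex gradient, of "x k" w]
      by (simp add: F_def G_def inner_diff_right)
    also have "\<dots> \<le> norm (G k) * norm (x k - w)" by (rule norm_cauchy_schwarz)
    also have "\<dots> \<le> norm (G k) * (norm (G k) / \<kappa>)"
      using error_bound(2)[of "x k"] error_bound(1)
      by (intro mult_left_mono) (auto simp: pos_le_divide_eq G_def w_def mult.commute)
    finally show ?thesis by (simp add: power2_eq_square)
  qed
  \<comment> \<open>The decrease is measured by \<parallel>G_k\<parallel>^2, but the abstract rate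
    needs the gap at k + 1. The gap bound contributes \<kappa>, and passing from G_(k+1) to G_k
    costs H^2.\<close>
  define b where "b = \<delta> * a * c * \<kappa> / H\<^sup>2"
  have b: "0 < b" using params a c error_bound(1) H by (simp add: b_def)
  have "b * (F (Suc k) - f xstar) \<le> refC l F k - F (Suc k)" for k
  proof -
    have "b * (F (Suc k) - f xstar) \<le> b * ((norm (G (Suc k)))\<^sup>2 / \<kappa>)"
      using gap b by (intro mult_left_mono) auto
    also have "\<dots> \<le> b * ((H * norm (G k))\<^sup>2 / \<kappa>)"
      using G_next b error_bound(1) by (intro mult_left_mono divide_right_mono power_mono) auto
    also have "\<dots> = \<delta> * a * c * (norm (G k))\<^sup>2"
      using H error_bound(1) by (simp add: b_def power_mult_distrib)
    also have "\<dots> \<le> \<delta> * \<alpha> k * c * (norm (G k))\<^sup>2"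
      using a_le params c by (intro mult_right_mono mult_left_mono) auto
    also note decrease[of k]
    finally show ?thesis .
  qed
  moreover have "f xstar \<le> F k" for k
    using minimizer by (simp add: F_def is_arg_min_linorder)
  ultimately show ?thesis
    using refC_linear_rate[of l b "f xstar" F] b by (simp add: l_def F_def)
qed

end
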